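(* Let $(\Omega,\mathcal A,\mu)$ be a probability space, $T:\Omega\to\Omega$ a measurable measure-preserving transformation, and $P:\mathbb L^1(\mu)\to\mathbb L^1(\mu)$ its Perron--Frobenius (transfer) operator. Let $(\mathcal B,\|\cdot\|)$ be a Banach space of $\mu$-measurable functions from $\Omega$ to $\mathbb R$ containing the constant function $\mathbf 1$, such that: (i) there exist $\kappa>0$ and $0<\theta<1$ such that for all $f\in\mathcal B$ and all $n$, $\|P^nf-\Pi f\|\le\kappa\theta^n\|f\|$, where $\Pi f=\mathbb E_\mu(f)\mathbf 1$; (ii) there exists $p\ge1$ such that $(\mathcal B,\|\cdot\|)$ is continuously included in $(\mathbb L^p(\mu),\|\cdot\|_p)$, i.e. there is $C>0$ with $\|f\|_p\le C\|f\|$ for all $f\in\mathcal B$; (iii) there exists $M>0$ such that $\|fP^nf\|\le M\|f\|\,\|P^nf\|$ for all $f\in\mathcal B$ and all integers $n\ge0$. Let $q\in[1,\infty]$ be defined by $\frac1p+\frac1q=1$. Then there exists a constant $K$ (not depending on $f$ or $n$) such that for all bounded $f\in\mathcal B$ with $\mathbb E_\mu(f)=0$, and all $n\ge 1$, writing $\mathrm m_f=\max\{1,\sup_x|f(x)|\}$, $$ \mathbb E_\mu\left[\left(\sum_{i=1}^nf\circ T^i\right)^4\right]\le K\,\mathrm m_f^3\left[n\|f\|_q\log^3(\|f\|+1)+n^2\|f\|_q^2\log^2(\|f\|+1)\right]. $$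
   Context: Measure-preserving means $\mu(T^{-1}A)=\mu(A)$ for all $A\in\mathcal A$. The Perron--Frobenius operator $P$ of $T$ is defined by $$\int_\Omega Pf(x)\,g(x)\,d\mu(x)=\int_\Omega f(x)\,g\circ T(x)\,d\mu(x)$$ for all $f\in\mathbb L^1(\mu)$ and $g\in\mathbb L^\infty(\mu)$; it is assumed to act on $\mathcal B$. $\mathbb E_\mu(f)=\int f\,d\mu$. The notation $\|\cdot\|$ without subscript is the norm of $\mathcal B$, and $\|\cdot\|_r$ is the $\mathbb L^r(\mu)$ norm for $r\in[1,\infty]$. Also $\log^k(x)=(\log x)^k$. *)

theory Defs
  imports "HOL-Probability.Probability"
begin

definition measure_preserving :: "'a measure \<Rightarrow> ('a \<Rightarrow> 'a) \<Rightarrow> bool" where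
  "measure_preserving \<mu> T \<longleftrightarrow>
     T \<in> measurable \<mu> \<mu> \<and>
     (\<forall>A\<in>sets \<mu>. emeasure \<mu> (T -` A \<inter> space \<mu>) = emeasure \<mu> A)"

text \<open>The exponent \<open>r\<close> ranges over \<open>[1, \<infinity>]\<close>. The elements of the \<open>L\<^sup>r\<close> space are functions, not
  equivalence classes. \<open>Lr_norm\<close> is meaningful on \<open>Lr_space\<close> only.\<close>

definition Lr_space :: "'a measure \<Rightarrow> ereal \<Rightarrow> ('a \<Rightarrow> real) set" where
  "Lr_space \<mu> r = {f \<in> borel_measurable \<mu>.
     if r = \<infinity> then esssup \<mu> (\<lambda>x. ereal \<bar>f x\<bar>) < \<infinity>
     else integrable \<mu> (\<lambda>x. \<bar>f x\<bar> powr real_of_ereal r)}"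

definition Lr_norm :: "'a measure \<Rightarrow> ereal \<Rightarrow> ('a \<Rightarrow> real) \<Rightarrow> real" where
  "Lr_norm \<mu> r f =
     (if r = \<infinity> then real_of_ereal (esssup \<mu> (\<lambda>x. ereal \<bar>f x\<bar>))
      else (\<integral>x. \<bar>f x\<bar> powr real_of_ereal r \<partial>\<mu>) powr (1 / real_of_ereal r))"

text \<open>A Banach space of measurable functions with carrier \<open>B\<close> and norm \<open>N\<close>. Only
  ``\<open>N f = 0\<close> implies \<open>f = 0\<close> almost everywhere'' is required for definiteness. This covers both
  a space of genuine functions, where \<open>N f = 0\<close> forces \<open>f = 0\<close> pointwise, and a space of
  almost-everywhere classes, for which \<open>B\<close> consists of all representatives and \<open>N\<close> vanishes
  exactly on the null functions.\<close>

definition banach_function_space ::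
    "'a measure \<Rightarrow> ('a \<Rightarrow> real) set \<Rightarrow> (('a \<Rightarrow> real) \<Rightarrow> real) \<Rightarrow> bool" where
  "banach_function_space \<mu> B N \<longleftrightarrow>
     B \<subseteq> borel_measurable \<mu> \<and>
     (\<lambda>_. 0) \<in> B \<and>
     (\<forall>f\<in>B. \<forall>g\<in>B. (\<lambda>x. f x + g x) \<in> B) \<and>
     (\<forall>c. \<forall>f\<in>B. (\<lambda>x. c * f x) \<in> B) \<and>
     (\<forall>f\<in>B. 0 \<le> N f) \<and>
     (\<forall>f\<in>B. N f = 0 \<longrightarrow> (AE x in \<mu>. f x = 0)) \<and>
     (\<forall>c. \<forall>f\<in>B. N (\<lambda>x. c * f x) = \<bar>c\<bar> * N f) \<and>
     (\<forall>f\<in>B. \<forall>g\<in>B. N (\<lambda>x. f x + g x) \<le> N f + N g) \<and>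
     (\<forall>u :: nat \<Rightarrow> 'a \<Rightarrow> real.
        (\<forall>n. u n \<in> B) \<longrightarrow>
        (\<forall>e>0. \<exists>k. \<forall>m\<ge>k. \<forall>n\<ge>k. N (\<lambda>x. u m x - u n x) < e) \<longrightarrow>
        (\<exists>f\<in>B. (\<lambda>n. N (\<lambda>x. u n x - f x)) \<longlonglongrightarrow> 0))"

text \<open>The defining relation determines \<open>P f\<close> only up to null sets: \<open>P\<close> is an arbitrary choice of
  versions of the Perron--Frobenius operator.\<close>

definition perron_frobenius ::
    "'a measure \<Rightarrow> ('a \<Rightarrow> 'a) \<Rightarrow> (('a \<Rightarrow> real) \<Rightarrow> ('a \<Rightarrow> real)) \<Rightarrow> bool" where
  "perron_frobenius \<mu> T P \<longleftrightarrow>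
     (\<forall>f. integrable \<mu> f \<longrightarrow>
        integrable \<mu> (P f) \<and>
        (\<forall>g\<in>Lr_space \<mu> \<infinity>. (\<integral>x. P f x * g x \<partial>\<mu>) = (\<integral>x. f x * g (T x) \<partial>\<mu>)))"

end

theory Submission
  imports Defs
begin

text \<open>After expanding the fourth power and sorting the four indices, stationarity reduces the claim
  to the sum over gaps \<open>i, j, k < n\<close> of the correlations
  \<open>\<integral> f \<cdot> f\<circ>T\<^sup>i \<cdot> f\<circ>T\<^bsup>i+j\<^esup> \<cdot> f\<circ>T\<^bsup>i+j+k\<^esup>\<close>. The spectral gap across any one of the three gaps,
  combined with Hoelder's inequality, gives a bound decaying exponentially in that gap; for the middle
  gap only after subtracting a product of two-point correlations, which is where the \<open>n\<^sup>2\<close> term comes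
  from. Capping each bound by the trivial one and taking the geometric mean of the three makes the sum
  factor into sums \<open>\<Sum>i. min 1 (t\<^sup>i N f / s)\<close>, each of order \<open>ln (1 + N f / s)\<close>; here \<open>s\<close> is an essential
  bound for \<open>f\<close>.

  The three bounds are comparable only if \<open>N f\<close> is bounded below by a multiple of \<open>s\<close>. This follows
  from the multiplicative hypothesis, which at \<open>n = 0\<close> bounds the norm of \<open>f\<^sup>2\<close> and thereby, by
  iterated squaring, gives \<open>\<bar>f\<bar> \<le> M N f\<close> almost everywhere.\<close>

section \<open>Elementary inequalities\<close>

text \<open>Makes sums of \<open>min 1\<close> along a geometric progression telescope. It combines
  \<open>ln z \<le> z - 1\<close> at \<open>z = (1 + t * x) / (1 + x)\<close> with
  \<open>min 1 x \<le> 2 * x / (1 + x)\<close>.\<close>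

lemma min_one_le_ln_diff:
  fixes t x :: real
  assumes "0 < t" "t < 1" "0 \<le> x"
  shows "min 1 x \<le> 2 / (1 - t) * (ln (1 + x) - ln (1 + t * x))"
proof -
  have pos: "0 < 1 + t * x" "0 < 1 + x" "0 < 1 - t"
    using assms by (auto simp: add_pos_nonneg)
  have "ln ((1 + t * x) / (1 + x)) \<le> (1 + t * x) / (1 + x) - 1"
    using pos by (intro ln_le_minus_one) auto
  also have "\<dots> = - ((1 - t) * x / (1 + x))"
    using pos by (simp add: field_simps)
  finally have *: "(1 - t) * x / (1 + x) \<le> ln (1 + x) - ln (1 + t * x)"
    using pos by (simp add: ln_div)
  have "min 1 x \<le> 2 * x / (1 + x)"
  proof (cases "x \<le> 1")
    case True
    then have "x * (1 + x) \<le> x * 2" using assms by (intro mult_left_mono) auto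
    with True pos show ?thesis by (simp add: field_simps)
  next
    case False
    with pos show ?thesis by (simp add: field_simps)
  qed
  also have "\<dots> = 2 / (1 - t) * ((1 - t) * x / (1 + x))"
    using pos by simp
  also have "\<dots> \<le> 2 / (1 - t) * (ln (1 + x) - ln (1 + t * x))"
    using * pos by (intro mult_left_mono) auto
  finally show ?thesis .
qed

lemma sum_min_one_geometric_le:
  fixes t y :: real
  assumes "0 < t" "t < 1" "0 \<le> y"
  shows "(\<Sum>i<n. min 1 (t ^ i * y)) \<le> 2 / (1 - t) * ln (1 + y)"
proof -
  have "(\<Sum>i<n. min 1 (t ^ i * y))
      \<le> (\<Sum>i<n. 2 / (1 - t) * (ln (1 + t ^ i * y) - ln (1 + t ^ Suc i * y)))"
    using assms min_one_le_ln_diff[OF assms(1,2), of "t ^ i * y" for i]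
    by (intro sum_mono) (auto simp: mult.assoc)
  also have "\<dots> = 2 / (1 - t) * (ln (1 + t ^ 0 * y) - ln (1 + t ^ n * y))"
    unfolding sum_distrib_left[symmetric] by (subst sum_lessThan_telescope') simp
  also have "\<dots> \<le> 2 / (1 - t) * ln (1 + y)"
    using assms by (intro mult_left_mono) auto
  finally show ?thesis .
qed

text \<open>Passes from the scale \<open>s\<close> of the correlation bounds, which may be far below
  1, to the quantities of the final estimate.\<close>

lemma mult_ln_one_add_divide_mono:
  fixes s m x :: real
  assumes "0 < s" "s \<le> m" "1 \<le> m" "0 \<le> x"
  shows "s * ln (1 + x / s) \<le> m * ln (x + 1)"
proof -
  define t where "t = min 1 s"
  have t: "0 < t" "t \<le> 1" "t \<le> s" using assms by (auto simp: t_def)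
  \<comment> \<open>For \<open>s \<le> 1\<close>, the point \<open>1 + x\<close> is the convex
    combination of \<open>1\<close> and \<open>1 + x / s\<close> with weight \<open>s\<close>, so
    concavity applies; for \<open>s > 1\<close> monotonicity suffices.\<close>
  have "t * ln (1 + x / s) \<le> ln (1 + x)"
  proof (cases "s \<le> 1")
    case True
    have "concave_on {0<..} (ln :: real \<Rightarrow> real)" by (rule ln_concave)
    from concave_onD[OF this, of s 1 "1 + x / s"] True assms
    have "s * ln (1 + x / s) \<le> ln ((1 - s) * 1 + s * (1 + x / s))"
      by (simp add: add_pos_nonneg)
    also have "(1 - s) * 1 + s * (1 + x / s) = 1 + x"
      using assms by (simp add: field_simps)
    finally show ?thesis using True by (simp add: t_def)
  next
    case False
    then have "x / s \<le> x / 1" using assms by (intro divide_left_mono) auto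
    with False assms show ?thesis by (simp add: t_def add_pos_nonneg)
  qed
  moreover have "s \<le> m * t"
    using assms mult_right_mono[of 1 m s] by (auto simp: t_def min_def)
  ultimately have "s * ln (1 + x / s) \<le> m * (t * ln (1 + x / s))"
    using assms by (metis (no_types) mult.assoc mult_right_mono ln_ge_zero le_add_same_cancel1 divide_nonneg_pos)
  also have "\<dots> \<le> m * ln (1 + x)"
    using \<open>t * ln (1 + x / s) \<le> ln (1 + x)\<close> assms by (intro mult_left_mono) auto
  finally show ?thesis by (simp add: add.commute)
qed

text \<open>Merges a trivial bound with a decaying one. The cubic form prepares the geometric mean
  over three gaps.\<close>

lemma le_mult_cube_min_one:
  fixes a b x y E t \<theta> :: real
  assumes "x \<le> a" "x \<le> b * (\<theta> ^ r * y ^ 3)" "a \<le> E" "b \<le> E" "0 \<le> y" "0 \<le> \<theta>" "t ^ 3 = \<theta>"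
  shows "x \<le> E * min 1 (t ^ r * y) ^ 3"
proof (cases "1 \<le> t ^ r * y")
  case True
  with assms show ?thesis by simp
next
  case False
  have "x \<le> E * (\<theta> ^ r * y ^ 3)"
    using assms(2) mult_right_mono[OF assms(4), of "\<theta> ^ r * y ^ 3"] assms(5,6) by simp
  also have "\<theta> ^ r * y ^ 3 = (t ^ r * y) ^ 3"
    by (simp add: assms(7)[symmetric] power_mult_distrib power_mult[symmetric] mult.commute)
  finally show ?thesis using False by simp
qed

text \<open>Stands in for the geometric mean of three bounds: the cube of the smallest of
  \<open>a\<close>, \<open>b\<close>, \<open>c\<close> is at most their product.\<close>

lemma le_mult_of_le_cubes:
  fixes x E a b c :: real
  assumes "x \<le> E * a ^ 3" "x \<le> E * b ^ 3" "x \<le> E * c ^ 3"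
    and "0 \<le> a" "0 \<le> b" "0 \<le> c" "0 \<le> E"
  shows "x \<le> E * (a * b * c)"
proof -
  define d where "d = min a (min b c)"
  have d: "0 \<le> d" "d \<le> a" "d \<le> b" "d \<le> c" using assms by (auto simp: d_def)
  have "x \<le> E * d ^ 3" using assms by (auto simp: d_def min_def)
  also have "d ^ 3 \<le> a * b * c"
    unfolding power3_eq_cube using d by (intro mult_mono) auto
  finally show ?thesis using \<open>0 \<le> E\<close> by (simp add: mult_left_mono)
qed

section \<open>Fourth powers of sums and sorted indices\<close>

text \<open>The last two indices are sorted first; each further step inserts one more index into the sorted
  ones, at one of 3, then 4, possible places.\<close>

lemma sum4_le_sorted:
  fixes F :: "'a :: linorder \<Rightarrow> 'a \<Rightarrow> 'a \<Rightarrow> 'a \<Rightarrow> real"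
  assumes nonneg: "\<And>a b c d. 0 \<le> F a b c d"
    and 1: "\<And>a b c d. F b a c d = F a b c d"
    and 2: "\<And>a b c d. F a c b d = F a b c d"
    and 3: "\<And>a b c d. F a b d c = F a b c d"
  shows "(\<Sum>a\<in>I. \<Sum>b\<in>I. \<Sum>c\<in>I. \<Sum>d\<in>I. F a b c d)
    \<le> 24 * (\<Sum>a\<in>I. \<Sum>b\<in>I. \<Sum>c\<in>I. \<Sum>d\<in>I. if a \<le> b \<and> b \<le> c \<and> c \<le> d then F a b c d else 0)"
proof -
  let ?S2 = "\<Sum>a\<in>I. \<Sum>b\<in>I. \<Sum>c\<in>I. \<Sum>d\<in>I. if c \<le> d then F a b c d else 0"
  let ?S3 = "\<Sum>a\<in>I. \<Sum>b\<in>I. \<Sum>c\<in>I. \<Sum>d\<in>I. if b \<le> c \<and> c \<le> d then F a b c d else 0"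
  let ?S4 = "\<Sum>a\<in>I. \<Sum>b\<in>I. \<Sum>c\<in>I. \<Sum>d\<in>I. if a \<le> b \<and> b \<le> c \<and> c \<le> d then F a b c d else 0"
  have sw12: "(\<Sum>a\<in>I. \<Sum>b\<in>I. \<Sum>c\<in>I. \<Sum>d\<in>I. G b a c d) = (\<Sum>a\<in>I. \<Sum>b\<in>I. \<Sum>c\<in>I. \<Sum>d\<in>I. G a b c d)"
    for G :: "'a \<Rightarrow> 'a \<Rightarrow> 'a \<Rightarrow> 'a \<Rightarrow> real"
    by (rule sum.swap)
  have sw23: "(\<Sum>a\<in>I. \<Sum>b\<in>I. \<Sum>c\<in>I. \<Sum>d\<in>I. G a c b d) = (\<Sum>a\<in>I. \<Sum>b\<in>I. \<Sum>c\<in>I. \<Sum>d\<in>I. G a b c d)"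
    for G :: "'a \<Rightarrow> 'a \<Rightarrow> 'a \<Rightarrow> 'a \<Rightarrow> real"
    by (rule sum.cong[OF refl], rule sum.swap)
  have sw34: "(\<Sum>a\<in>I. \<Sum>b\<in>I. \<Sum>c\<in>I. \<Sum>d\<in>I. G a b d c) = (\<Sum>a\<in>I. \<Sum>b\<in>I. \<Sum>c\<in>I. \<Sum>d\<in>I. G a b c d)"
    for G :: "'a \<Rightarrow> 'a \<Rightarrow> 'a \<Rightarrow> 'a \<Rightarrow> real"
    by (rule sum.cong[OF refl], rule sum.cong[OF refl], rule sum.swap)
  let ?f2 = "\<lambda>a b c d. if c \<le> d then F a b c d else 0"
  let ?f3 = "\<lambda>a b c d. if b \<le> c \<and> c \<le> d then F a b c d else 0"
  let ?f4 = "\<lambda>a b c d. if a \<le> b \<and> b \<le> c \<and> c \<le> d then F a b c d else 0"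
  \<comment> \<open>Only an inequality: terms with \<open>c = d\<close> are counted twice, which
    nonnegativity allows. The later insertions are alike, and the factors 2, 3, 4 multiply to
    24.\<close>
  have "(\<Sum>a\<in>I. \<Sum>b\<in>I. \<Sum>c\<in>I. \<Sum>d\<in>I. F a b c d)
      \<le> (\<Sum>a\<in>I. \<Sum>b\<in>I. \<Sum>c\<in>I. \<Sum>d\<in>I. ?f2 a b c d + ?f2 a b d c)"
    by (intro sum_mono) (auto simp: nonneg 3)
  also have "\<dots> = 2 * ?S2"
    by (simp only: sum.distrib sw34[of ?f2])
  finally have S2: "(\<Sum>a\<in>I. \<Sum>b\<in>I. \<Sum>c\<in>I. \<Sum>d\<in>I. F a b c d) \<le> 2 * ?S2" .
  have "?S2 \<le> (\<Sum>a\<in>I. \<Sum>b\<in>I. \<Sum>c\<in>I. \<Sum>d\<in>I. ?f3 a b c d + ?f3 a c b d + ?f3 a c d b)"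
    by (intro sum_mono) (auto simp: nonneg 2 3)
  also have "\<dots> = 3 * ?S3"
    by (simp only: sum.distrib sw23[of ?f3] sw34[of ?f3] sw23[of "\<lambda>a b c d. ?f3 a b d c"])
  finally have S3: "?S2 \<le> 3 * ?S3" .
  have "?S3 \<le> (\<Sum>a\<in>I. \<Sum>b\<in>I. \<Sum>c\<in>I. \<Sum>d\<in>I.
      ?f4 a b c d + ?f4 b a c d + ?f4 b c a d + ?f4 b c d a)"
    by (intro sum_mono) (auto simp: nonneg 1 2 3)
  also have "\<dots> = 4 * ?S4"
    by (simp only: sum.distrib sw12[of ?f4] sw23[of ?f4] sw34[of ?f4]
      sw12[of "\<lambda>a b c d. ?f4 a c b d"] sw12[of "\<lambda>a b c d. ?f4 a c d b"]
      sw23[of "\<lambda>a b c d. ?f4 a b d c"])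
  finally show ?thesis using S2 S3 by simp
qed

text \<open>By stationarity the starting index contributes only a factor \<open>n\<close>. Letting
  the three gaps range freely below \<open>n\<close> adds only nonnegative terms.\<close>

lemma sum4_sorted_le_gaps:
  fixes F :: "nat \<Rightarrow> nat \<Rightarrow> nat \<Rightarrow> nat \<Rightarrow> real" and A :: "nat \<Rightarrow> nat \<Rightarrow> nat \<Rightarrow> real"
  assumes F: "\<And>a i j k. F a (a + i) (a + i + j) (a + i + j + k) = A i j k"
    and nonneg: "\<And>i j k. 0 \<le> A i j k"
  shows "(\<Sum>a=1..n. \<Sum>b=1..n. \<Sum>c=1..n. \<Sum>d=1..n.
      if a \<le> b \<and> b \<le> c \<and> c \<le> d then F a b c d else 0)
    \<le> real n * (\<Sum>i<n. \<Sum>j<n. \<Sum>k<n. A i j k)"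
proof -
  have shift: "(\<Sum>b=1..n. if a \<le> b then g b else 0) \<le> (\<Sum>i<n. g (a + i))"
    if "a \<in> {1..n}" "\<And>b. 0 \<le> g b" for a and g :: "nat \<Rightarrow> real"
  proof -
    have "(\<Sum>b=1..n. if a \<le> b then g b else 0) = (\<Sum>b\<in>{a..n}. g b)"
      using that(1) by (intro sum.mono_neutral_cong_right) auto
    also have "\<dots> = (\<Sum>i\<in>{..n - a}. g (a + i))"
      using that(1) by (intro sum.reindex_bij_witness[of _ "\<lambda>i. a + i" "\<lambda>b. b - a"]) auto
    also have "\<dots> \<le> (\<Sum>i<n. g (a + i))"
      using that by (intro sum_mono2) auto
    finally show ?thesis .
  qed
  have F0: "0 \<le> F a b c d" if "a \<le> b" "b \<le> c" "c \<le> d" for a b c d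
    using F[of a "b - a" "c - b" "d - c"] that nonneg[of "b - a" "c - b" "d - c"] by simp
  let ?G = "\<lambda>a b c d. if a \<le> b \<and> b \<le> c \<and> c \<le> d then F a b c d else 0"
  have G0: "0 \<le> ?G a b c d" for a b c d using F0 by auto
  \<comment> \<open>A condition implied by the sorting is made explicit, since \<open>shift\<close>
    expects it; the outer sums are treated likewise.\<close>
  have split: "?G a b c d = (if c \<le> d then ?G a b c d else 0)" for a b c d
    by auto
  have d: "(\<Sum>d=1..n. ?G a b c d) \<le> (\<Sum>k<n. ?G a b c (c + k))" if "c \<in> {1..n}" for a b c
    using shift[OF that, of "?G a b c", OF G0] by (simp only: split[symmetric])
  have c: "(\<Sum>c=1..n. \<Sum>d=1..n. ?G a b c d) \<le> (\<Sum>j<n. \<Sum>k<n. ?G a b (b + j) (b + j + k))"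
    if "b \<in> {1..n}" for a b
  proof -
    have "(\<Sum>c=1..n. \<Sum>d=1..n. ?G a b c d) \<le> (\<Sum>c=1..n. \<Sum>k<n. ?G a b c (c + k))"
      by (intro sum_mono d)
    also have "\<dots> = (\<Sum>c=1..n. if b \<le> c then \<Sum>k<n. ?G a b c (c + k) else 0)"
      by (intro sum.cong) auto
    also have "\<dots> \<le> (\<Sum>j<n. \<Sum>k<n. ?G a b (b + j) (b + j + k))"
      by (intro shift[OF that] sum_nonneg G0)
    finally show ?thesis .
  qed
  have b: "(\<Sum>b=1..n. \<Sum>c=1..n. \<Sum>d=1..n. ?G a b c d) \<le> (\<Sum>i<n. \<Sum>j<n. \<Sum>k<n. A i j k)"
    if "a \<in> {1..n}" for a
  proof -
    have "(\<Sum>b=1..n. \<Sum>c=1..n. \<Sum>d=1..n. ?G a b c d)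
        \<le> (\<Sum>b=1..n. \<Sum>j<n. \<Sum>k<n. ?G a b (b + j) (b + j + k))"
      by (intro sum_mono c)
    also have "\<dots> = (\<Sum>b=1..n. if a \<le> b then \<Sum>j<n. \<Sum>k<n. ?G a b (b + j) (b + j + k) else 0)"
      by (intro sum.cong) auto
    also have "\<dots> \<le> (\<Sum>i<n. \<Sum>j<n. \<Sum>k<n. ?G a (a + i) (a + i + j) (a + i + j + k))"
      by (intro shift[OF that] sum_nonneg G0)
    finally show ?thesis by (simp add: F)
  qed
  have "(\<Sum>a=1..n. \<Sum>b=1..n. \<Sum>c=1..n. \<Sum>d=1..n. ?G a b c d)
      \<le> (\<Sum>a=1..n. \<Sum>i<n. \<Sum>j<n. \<Sum>k<n. A i j k)"
    by (intro sum_mono b)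
  then show ?thesis by simp
qed

lemma power4_sum_eq:
  fixes x :: "'i \<Rightarrow> real"
  shows "(\<Sum>i\<in>I. x i) ^ 4 = (\<Sum>a\<in>I. \<Sum>b\<in>I. \<Sum>c\<in>I. \<Sum>d\<in>I. x a * x b * x c * x d)"
  by (simp add: power4_eq_xxxx sum_distrib_left sum_distrib_right mult_ac)

section \<open>Lebesgue norms and measure-preserving maps\<close>

text \<open>Membership makes the essential supremum finite; \<open>real_of_ereal\<close> would send
  an infinite one to 0.\<close>

lemma Lr_infinity_AE:
  assumes "f \<in> Lr_space \<mu> \<infinity>"
  shows "AE x in \<mu>. \<bar>f x\<bar> \<le> Lr_norm \<mu> \<infinity> f"
proof -
  let ?e = "esssup \<mu> (\<lambda>x. ereal \<bar>f x\<bar>)"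
  have "?e < \<infinity>" using assms by (simp add: Lr_space_def)
  have "AE x in \<mu>. ereal \<bar>f x\<bar> \<le> ?e" by (rule esssup_AE)
  then show ?thesis
  proof eventually_elim
    case (elim x)
    with \<open>?e < \<infinity>\<close> show ?case by (cases ?e) (auto simp: Lr_norm_def)
  qed
qed

lemma (in prob_space) Lr_norm_nonneg:
  assumes "r = \<infinity> \<Longrightarrow> f \<in> Lr_space M \<infinity>"
  shows "0 \<le> Lr_norm M r f"
proof (cases "r = \<infinity>")
  case True
  then have "AE x in M. \<bar>f x\<bar> \<le> Lr_norm M \<infinity> f" using assms Lr_infinity_AE by blast
  then have "AE x in M. 0 \<le> Lr_norm M \<infinity> f" by eventually_elim linarith
  then show ?thesis using True by simp
next
  case False
  then show ?thesis by (simp add: Lr_norm_def)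
qed

lemma (in finite_measure) AE_bounded_imp_Lr:
  assumes [measurable]: "f \<in> borel_measurable M" and "AE x in M. \<bar>f x\<bar> \<le> s" and "1 \<le> r"
  shows "f \<in> Lr_space M r"
proof (cases "r = \<infinity>")
  case True
  have "esssup M (\<lambda>x. ereal \<bar>f x\<bar>) \<le> ereal s"
    using assms(2) by (intro esssup_I) auto
  then show ?thesis using True by (auto simp: Lr_space_def)
next
  case False
  have "0 \<le> real_of_ereal r" using order_trans[of 0 1 r] \<open>1 \<le> r\<close> by (simp add: real_of_ereal_pos)
  then have "AE x in M. norm (\<bar>f x\<bar> powr real_of_ereal r) \<le> s powr real_of_ereal r"
    using assms(2) by (auto elim!: eventually_mono intro!: powr_mono2)
  then have "integrable M (\<lambda>x. \<bar>f x\<bar> powr real_of_ereal r)"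
    by (rule integrable_const_bound) simp
  then show ?thesis using False by (simp add: Lr_space_def)
qed

section \<open>Hoelder's inequality\<close>

lemma Lr_Holder_infinity:
  assumes u: "u \<in> Lr_space \<mu> \<infinity>" and v: "v \<in> Lr_space \<mu> 1"
  shows "integrable \<mu> (\<lambda>x. u x * v x)"
    and "(\<integral>x. \<bar>u x * v x\<bar> \<partial>\<mu>) \<le> Lr_norm \<mu> \<infinity> u * Lr_norm \<mu> 1 v"
proof -
  have [measurable]: "u \<in> borel_measurable \<mu>" "v \<in> borel_measurable \<mu>"
    using u v by (auto simp: Lr_space_def)
  let ?a = "Lr_norm \<mu> \<infinity> u"
  have vi: "integrable \<mu> (\<lambda>x. \<bar>v x\<bar>)" using v by (simp add: Lr_space_def)
  have "AE x in \<mu>. \<bar>u x * v x\<bar> \<le> ?a * \<bar>v x\<bar>"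
    using Lr_infinity_AE[OF u] by eventually_elim (simp add: abs_mult mult_right_mono)
  moreover have i2: "integrable \<mu> (\<lambda>x. ?a * \<bar>v x\<bar>)" using vi by simp
  ultimately show i: "integrable \<mu> (\<lambda>x. u x * v x)"
    by (intro Bochner_Integration.integrable_bound[OF i2]) (auto elim: eventually_mono)
  have "(\<integral>x. \<bar>u x * v x\<bar> \<partial>\<mu>) \<le> (\<integral>x. ?a * \<bar>v x\<bar> \<partial>\<mu>)"
    using i i2 \<open>AE x in \<mu>. \<bar>u x * v x\<bar> \<le> ?a * \<bar>v x\<bar>\<close> by (intro integral_mono_AE) auto
  also have "\<dots> = ?a * Lr_norm \<mu> 1 v"
    by (simp add: Lr_norm_def[of \<mu> 1])
  finally show "(\<integral>x. \<bar>u x * v x\<bar> \<partial>\<mu>) \<le> ?a * Lr_norm \<mu> 1 v" .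
qed

text \<open>Young's inequality, integrated after dividing each function by its norm.\<close>

lemma Holder_integral:
  fixes u v :: "'a \<Rightarrow> real" and p q :: real
  assumes pq: "1 < p" "1 < q" "1 / p + 1 / q = 1"
    and [measurable]: "u \<in> borel_measurable \<mu>" "v \<in> borel_measurable \<mu>"
    and u: "integrable \<mu> (\<lambda>x. \<bar>u x\<bar> powr p)" and v: "integrable \<mu> (\<lambda>x. \<bar>v x\<bar> powr q)"
  shows "integrable \<mu> (\<lambda>x. u x * v x)"
    and "(\<integral>x. \<bar>u x * v x\<bar> \<partial>\<mu>)
      \<le> (\<integral>x. \<bar>u x\<bar> powr p \<partial>\<mu>) powr (1 / p) * (\<integral>x. \<bar>v x\<bar> powr q \<partial>\<mu>) powr (1 / q)"
proof -
  define U where "U = (\<integral>x. \<bar>u x\<bar> powr p \<partial>\<mu>)"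
  define V where "V = (\<integral>x. \<bar>v x\<bar> powr q \<partial>\<mu>)"
  have "0 \<le> U" "0 \<le> V" unfolding U_def V_def by (auto intro: Bochner_Integration.integral_nonneg)
  have i2: "integrable \<mu> (\<lambda>x. \<bar>u x\<bar> powr p / p + \<bar>v x\<bar> powr q / q)"
    using u v by simp
  show i: "integrable \<mu> (\<lambda>x. u x * v x)"
    using Youngs_inequality[OF pq] by (intro Bochner_Integration.integrable_bound[OF i2])
      (auto simp: abs_mult intro!: AE_I2 order_trans[OF Youngs_inequality[OF pq]])
  have "(\<integral>x. \<bar>u x * v x\<bar> \<partial>\<mu>) \<le> U powr (1 / p) * V powr (1 / q)"
  proof (cases "U = 0 \<or> V = 0")
    \<comment> \<open>One cannot divide by a vanishing norm, but then one factor, hence the product,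
      is zero almost everywhere.\<close>
    case True
    then have "(AE x in \<mu>. \<bar>u x\<bar> powr p = 0) \<or> (AE x in \<mu>. \<bar>v x\<bar> powr q = 0)"
      using u v unfolding U_def V_def by (subst (asm) (1 2) integral_nonneg_eq_0_iff_AE) auto
    then have "AE x in \<mu>. \<bar>u x * v x\<bar> = 0"
      by (elim disjE) (auto elim: eventually_mono)
    then have "(\<integral>x. \<bar>u x * v x\<bar> \<partial>\<mu>) = (\<integral>x. 0 \<partial>\<mu>)"
      by (intro integral_cong_AE) auto
    then show ?thesis by simp
  next
    case False
    define a where "a = U powr (1 / p)"
    define b where "b = V powr (1 / q)"
    have ab: "0 < a" "0 < b" "a powr p = U" "b powr q = V"
      using False \<open>0 \<le> U\<close> \<open>0 \<le> V\<close> pq by (auto simp: a_def b_def powr_powr)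
    have *: "\<bar>u x * v x\<bar> \<le> a * b * (\<bar>u x\<bar> powr p / U / p + \<bar>v x\<bar> powr q / V / q)" for x
    proof -
      have "\<bar>u x\<bar> / a * (\<bar>v x\<bar> / b) \<le> (\<bar>u x\<bar> / a) powr p / p + (\<bar>v x\<bar> / b) powr q / q"
        using ab by (intro Youngs_inequality[OF pq]) auto
      also have "\<dots> = \<bar>u x\<bar> powr p / U / p + \<bar>v x\<bar> powr q / V / q"
        using ab by (simp add: powr_divide)
      finally show ?thesis using ab by (simp add: abs_mult field_simps)
    qed
    have "(\<integral>x. \<bar>u x * v x\<bar> \<partial>\<mu>)
        \<le> (\<integral>x. a * b * (\<bar>u x\<bar> powr p / U / p + \<bar>v x\<bar> powr q / V / q) \<partial>\<mu>)"
      using i u v * by (intro integral_mono) auto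
    also have "\<dots> = a * b * (U / U / p + V / V / q)"
      using u v by (simp add: U_def V_def)
    also have "\<dots> = a * b" using False pq by simp
    finally show ?thesis by (simp add: a_def b_def)
  qed
  then show "(\<integral>x. \<bar>u x * v x\<bar> \<partial>\<mu>)
      \<le> (\<integral>x. \<bar>u x\<bar> powr p \<partial>\<mu>) powr (1 / p) * (\<integral>x. \<bar>v x\<bar> powr q \<partial>\<mu>) powr (1 / q)"
    by (simp add: U_def V_def)
qed

text \<open>In the extended reals \<open>1 / \<infinity> = 0\<close>, so an infinite exponent forces
  the other to be 1, while two finite exponents both exceed 1.\<close>

lemma Lr_Holder:
  assumes pq: "1 \<le> p" "1 \<le> q" "1 / p + 1 / q = (1 :: ereal)"
    and u: "u \<in> Lr_space \<mu> p" and v: "v \<in> Lr_space \<mu> q"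
  shows "integrable \<mu> (\<lambda>x. u x * v x)"
    and "(\<integral>x. \<bar>u x * v x\<bar> \<partial>\<mu>) \<le> Lr_norm \<mu> p u * Lr_norm \<mu> q v"
proof -
  have "integrable \<mu> (\<lambda>x. u x * v x) \<and>
    (\<integral>x. \<bar>u x * v x\<bar> \<partial>\<mu>) \<le> Lr_norm \<mu> p u * Lr_norm \<mu> q v"
  proof (cases p)
    case (real p')
    show ?thesis
    proof (cases q)
      case (real q')
      have "1 \<le> p'" "1 \<le> q'" and eq: "1 / p' + 1 / q' = 1"
        using pq \<open>p = ereal p'\<close> \<open>q = ereal q'\<close> by (auto simp: one_ereal_def)
      then have "p' \<noteq> 1" "q' \<noteq> 1" by auto
      with \<open>1 \<le> p'\<close> \<open>1 \<le> q'\<close> eq Holder_integral[of p' q' u \<mu> v] u v show ?thesis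
        unfolding \<open>p = ereal p'\<close> \<open>q = ereal q'\<close> by (simp add: Lr_space_def Lr_norm_def)
    next
      case PInf
      with pq \<open>p = ereal p'\<close> have "p = 1" by (auto simp: one_ereal_def)
      with PInf u v Lr_Holder_infinity[of v \<mu> u] show ?thesis by (simp add: mult.commute)
    qed (use pq in auto)
  next
    case PInf
    with pq have "q = 1" by (cases q) (auto simp: one_ereal_def)
    with PInf u v Lr_Holder_infinity[of u \<mu> v] show ?thesis by simp
  qed (use pq in auto)
  then show "integrable \<mu> (\<lambda>x. u x * v x)"
    and "(\<integral>x. \<bar>u x * v x\<bar> \<partial>\<mu>) \<le> Lr_norm \<mu> p u * Lr_norm \<mu> q v" by auto
qed

section \<open>Measure-preserving maps and powers of the transfer operator\<close>

lemma measure_preserving_distr: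
  assumes "measure_preserving \<mu> T"
  shows "distr \<mu> \<mu> T = \<mu>"
  using assms by (intro measure_eqI) (auto simp: measure_preserving_def emeasure_distr)

lemma measure_preserving_funpow:
  assumes "measure_preserving \<mu> T"
  shows "measure_preserving \<mu> (T ^^ n)"
proof (induction n)
  case 0
  then show ?case by (auto simp: measure_preserving_def)
next
  case (Suc n)
  note [measurable] = assms[unfolded measure_preserving_def, THEN conjunct1]
    Suc[unfolded measure_preserving_def, THEN conjunct1]
  have "emeasure \<mu> ((T ^^ Suc n) -` A \<inter> space \<mu>) = emeasure \<mu> A" if [measurable]: "A \<in> sets \<mu>" for A
  proof -
    have "(T ^^ Suc n) -` A \<inter> space \<mu> = (T ^^ n) -` (T -` A \<inter> space \<mu>) \<inter> space \<mu>"
      using measurable_space[of "T ^^ n" \<mu> \<mu>] Suc by (auto simp: measure_preserving_def)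
    moreover have "T -` A \<inter> space \<mu> \<in> sets \<mu>" by measurable
    ultimately show ?thesis using Suc assms that unfolding measure_preserving_def by metis
  qed
  moreover have "T ^^ Suc n \<in> measurable \<mu> \<mu>" by simp
  ultimately show ?case unfolding measure_preserving_def by blast
qed

lemma AE_measure_preserving:
  assumes "measure_preserving \<mu> T" and "AE x in \<mu>. R x"
  shows "AE x in \<mu>. R (T x)"
proof (rule AE_distrD[of T \<mu> \<mu>])
  show "T \<in> measurable \<mu> \<mu>" using assms(1) by (simp add: measure_preserving_def)
  show "AE x in distr \<mu> \<mu> T. R x" using assms(2) by (simp only: measure_preserving_distr[OF assms(1)])
qed

lemma integral_measure_preserving:
  fixes g :: "'a \<Rightarrow> real"
  assumes "measure_preserving \<mu> T" and [measurable]: "g \<in> borel_measurable \<mu>"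
  shows "(\<integral>x. g (T x) \<partial>\<mu>) = (\<integral>x. g x \<partial>\<mu>)"
  using integral_distr[of T \<mu> \<mu> g] measure_preserving_distr[OF assms(1)] assms
  by (simp add: measure_preserving_def)

text \<open>Induction with \<open>g\<close> arbitrary: duality for the outermost \<open>P\<close>
  composes \<open>g\<close> with \<open>T\<close>, and invariance of the measure keeps the result
  essentially bounded.\<close>

lemma (in finite_measure) integral_perron_frobenius_funpow:
  assumes T: "measure_preserving M T" and P: "perron_frobenius M T P"
    and f: "integrable M f"
    and g: "g \<in> borel_measurable M" "AE x in M. \<bar>g x\<bar> \<le> s"
  shows "integrable M ((P ^^ n) f) \<and>
    (\<integral>x. (P ^^ n) f x * g x \<partial>M) = (\<integral>x. f x * g ((T ^^ n) x) \<partial>M)"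
  using g
proof (induction n arbitrary: g)
  case 0
  then show ?case using f by simp
next
  case (Suc n)
  have [measurable]: "T \<in> measurable M M" using T by (simp add: measure_preserving_def)
  have *: "(\<lambda>x. g (T x)) \<in> borel_measurable M" "AE x in M. \<bar>g (T x)\<bar> \<le> s"
    using Suc.prems AE_measure_preserving[OF T, of "\<lambda>x. \<bar>g x\<bar> \<le> s"] by auto
  have "g \<in> Lr_space M \<infinity>" using Suc.prems by (intro AE_bounded_imp_Lr) auto
  with Suc.IH[OF *] P show ?case by (simp add: perron_frobenius_def)
qed

section \<open>Function spaces with a spectral gap\<close>

text \<open>All data except the observable are fixed, so no constant defined here depends on
  \<open>f\<close> or \<open>n\<close>.\<close>

locale spectral_gap_space = prob_space \<mu> for \<mu> :: "'a measure" +
  fixes T :: "'a \<Rightarrow> 'a"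
    and P :: "('a \<Rightarrow> real) \<Rightarrow> ('a \<Rightarrow> real)"
    and B :: "('a \<Rightarrow> real) set"
    and N :: "('a \<Rightarrow> real) \<Rightarrow> real"
    and \<kappa> \<theta> C M :: real
    and p q :: ereal
  assumes T: "measure_preserving \<mu> T"
    and P: "perron_frobenius \<mu> T P"
    and B: "banach_function_space \<mu> B N"
    and one_in_B: "(\<lambda>_. 1) \<in> B"
    and P_in_B: "f \<in> B \<Longrightarrow> P f \<in> B"
    and \<kappa>: "0 < \<kappa>" and \<theta>: "0 < \<theta>" "\<theta> < 1"
    and gap: "f \<in> B \<Longrightarrow> N (\<lambda>x. (P ^^ n) f x - (\<integral>y. f y \<partial>\<mu>)) \<le> \<kappa> * \<theta> ^ n * N f"
    and p: "1 \<le> p" and B_Lp: "B \<subseteq> Lr_space \<mu> p"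
    and C: "0 < C" and Lp_le_N: "f \<in> B \<Longrightarrow> Lr_norm \<mu> p f \<le> C * N f"
    and M: "0 < M"
    and mult_funpow: "f \<in> B \<Longrightarrow> (\<lambda>x. f x * (P ^^ n) f x) \<in> B \<and>
      N (\<lambda>x. f x * (P ^^ n) f x) \<le> M * N f * N ((P ^^ n) f)"
    and q: "1 \<le> q" and pq: "1 / p + 1 / q = 1"
begin

lemma B_measurable: "f \<in> B \<Longrightarrow> f \<in> borel_measurable \<mu>"
  and B_add: "f \<in> B \<Longrightarrow> g \<in> B \<Longrightarrow> (\<lambda>x. f x + g x) \<in> B"
  and B_scale: "f \<in> B \<Longrightarrow> (\<lambda>x. a * f x) \<in> B"
  and N_nonneg: "f \<in> B \<Longrightarrow> 0 \<le> N f"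
  and N_scale: "f \<in> B \<Longrightarrow> N (\<lambda>x. a * f x) = \<bar>a\<bar> * N f"
  and N_triangle: "f \<in> B \<Longrightarrow> g \<in> B \<Longrightarrow> N (\<lambda>x. f x + g x) \<le> N f + N g"
  using B by (auto simp: banach_function_space_def)

lemma B_diff_const: "f \<in> B \<Longrightarrow> (\<lambda>x. f x - a) \<in> B"
  using B_add[OF _ B_scale[OF one_in_B, of "- a"], of f] by simp

lemma B_funpow: "f \<in> B \<Longrightarrow> (P ^^ n) f \<in> B"
  by (induction n) (auto intro: P_in_B)

text \<open>The inclusion of \<open>B\<close> into the \<open>p\<close>-space enters here: one
  factor is measured by \<open>N\<close>, the other in the dual exponent.\<close>

lemma B_Holder:
  assumes "u \<in> B" "v \<in> Lr_space \<mu> q"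
  shows "integrable \<mu> (\<lambda>x. u x * v x)"
    and "(\<integral>x. \<bar>u x * v x\<bar> \<partial>\<mu>) \<le> C * N u * Lr_norm \<mu> q v"
proof -
  have u: "u \<in> Lr_space \<mu> p" using assms B_Lp by auto
  show "integrable \<mu> (\<lambda>x. u x * v x)" by (rule Lr_Holder[OF p q pq u assms(2)])
  have "(\<integral>x. \<bar>u x * v x\<bar> \<partial>\<mu>) \<le> Lr_norm \<mu> p u * Lr_norm \<mu> q v"
    by (rule Lr_Holder[OF p q pq u assms(2)])
  also have "\<dots> \<le> C * N u * Lr_norm \<mu> q v"
  proof (intro mult_right_mono Lp_le_N Lr_norm_nonneg)
    show "v \<in> Lr_space \<mu> \<infinity>" if "q = \<infinity>" using that assms(2) by simp
  qed (rule assms(1))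
  finally show "(\<integral>x. \<bar>u x * v x\<bar> \<partial>\<mu>) \<le> C * N u * Lr_norm \<mu> q v" .
qed

lemma one_in_Lq: "(\<lambda>_. 1) \<in> Lr_space \<mu> q"
  by (rule AE_bounded_imp_Lr[OF _ _ q, of _ 1]) auto

text \<open>A constant for the inclusion of \<open>B\<close> into the integrable functions, from
  Hoelder against 1.\<close>

definition c1 where "c1 = C * Lr_norm \<mu> q (\<lambda>_. 1)"

lemma c1_nonneg: "0 \<le> c1"
proof -
  have "0 \<le> Lr_norm \<mu> q (\<lambda>_. 1)"
  proof (rule Lr_norm_nonneg)
    show "(\<lambda>_. 1) \<in> Lr_space \<mu> \<infinity>" if "q = \<infinity>" using one_in_Lq that by simp
  qed
  then show ?thesis using C by (simp add: c1_def)
qed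

lemma B_integrable: "u \<in> B \<Longrightarrow> integrable \<mu> u"
  using B_Holder(1)[OF _ one_in_Lq] by simp

lemma L1_le_N: "u \<in> B \<Longrightarrow> (\<integral>x. \<bar>u x\<bar> \<partial>\<mu>) \<le> c1 * N u"
  using B_Holder(2)[OF _ one_in_Lq] by (simp add: c1_def mult_ac)

text \<open>Bounds all powers of \<open>P\<close> on \<open>B\<close> at once:
  \<open>\<kappa>\<close> covers the deviation from the mean, the second term the mean
  itself.\<close>

definition L where "L = \<kappa> + c1 * N (\<lambda>_. 1)"

lemma L_pos: "0 < L"
  using \<kappa> c1_nonneg N_nonneg[OF one_in_B] by (simp add: L_def add_pos_nonneg)

lemma N_funpow_le:
  assumes "u \<in> B"
  shows "N ((P ^^ n) u) \<le> L * N u"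
proof -
  define e where "e = (\<integral>x. u x \<partial>\<mu>)"
  have "\<bar>e\<bar> \<le> (\<integral>x. \<bar>u x\<bar> \<partial>\<mu>)" unfolding e_def by (rule integral_abs_bound)
  also have "\<dots> \<le> c1 * N u" by (rule L1_le_N[OF assms])
  finally have e: "\<bar>e\<bar> \<le> c1 * N u" .
  have "N ((P ^^ n) u) \<le> N (\<lambda>x. (P ^^ n) u x - e) + N (\<lambda>_. e * 1)"
    using N_triangle[OF B_diff_const[OF B_funpow[OF assms]] B_scale[OF one_in_B], of n e e] by simp
  also have "N (\<lambda>x. (P ^^ n) u x - e) \<le> \<kappa> * \<theta> ^ n * N u"
    unfolding e_def by (rule gap[OF assms])
  also have "\<dots> \<le> \<kappa> * 1 * N u"
    using \<kappa> \<theta> N_nonneg[OF assms] by (intro mult_right_mono mult_left_mono power_le_one) auto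
  also have "N (\<lambda>_. e * 1) = \<bar>e\<bar> * N (\<lambda>_. 1)" by (rule N_scale[OF one_in_B])
  also have "\<dots> \<le> c1 * N u * N (\<lambda>_. 1)"
    by (intro mult_right_mono e N_nonneg one_in_B)
  finally show ?thesis by (simp add: L_def algebra_simps)
qed

section \<open>Products and essential bounds in \<open>B\<close>\<close>

lemma N_square: "u \<in> B \<Longrightarrow> (\<lambda>x. u x * u x) \<in> B \<and> N (\<lambda>x. u x * u x) \<le> M * (N u * N u)"
  using mult_funpow[of u 0] by (simp add: mult.assoc)

text \<open>Polarization extends the bound on squares to arbitrary products.\<close>

lemma N_mult_le:
  assumes u: "u \<in> B" "N u \<le> a" "0 < a" and v: "v \<in> B" "N v \<le> b" "0 < b"
  shows "(\<lambda>x. u x * v x) \<in> B" and "N (\<lambda>x. u x * v x) \<le> 2 * M * a * b"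
proof -
  \<comment> \<open>Scaling by the bounds makes both parts of norm at most 1. The squares of
    \<open>w 1\<close> and \<open>w (-1)\<close> differ by \<open>4 / (a * b)\<close> times the
    product \<open>u x * v x\<close>.\<close>
  define w where "w e x = 1 / a * u x + e / b * v x" for e x
  have wB: "w e \<in> B" for e
    unfolding w_def by (intro B_add B_scale u v)
  have wN: "N (w e) \<le> 2" if "\<bar>e\<bar> = 1" for e
  proof -
    have "N (w e) \<le> N (\<lambda>x. 1 / a * u x) + N (\<lambda>x. e / b * v x)"
      unfolding w_def by (intro N_triangle B_scale u v)
    also have "\<dots> = \<bar>1 / a\<bar> * N u + \<bar>e / b\<bar> * N v"
      by (simp only: N_scale[OF u(1)] N_scale[OF v(1)])
    also have "\<dots> = N u / a + N v / b"
      using u v that by simp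
    also have "\<dots> \<le> 1 + 1" using u v by (intro add_mono) auto
    finally show ?thesis by simp
  qed
  define z where "z e x = w e x * w e x" for e x
  have zB: "z e \<in> B" for e unfolding z_def using N_square[OF wB] by blast
  have zN: "N (z e) \<le> M * 4" if "\<bar>e\<bar> = 1" for e
  proof -
    have "N (z e) \<le> M * (N (w e) * N (w e))" unfolding z_def using N_square[OF wB] by blast
    also have "\<dots> \<le> M * (2 * 2)"
      using wN[OF that] N_nonneg[OF wB] M by (intro mult_left_mono mult_mono) auto
    finally show ?thesis by simp
  qed
  have eq: "(\<lambda>x. u x * v x) = (\<lambda>x. a * b / 4 * (z 1 x + -1 * z (-1) x))"
    using u(3) v(3) by (auto simp: z_def w_def field_simps)
  show "(\<lambda>x. u x * v x) \<in> B" unfolding eq by (intro B_scale B_add zB)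
  have "N (\<lambda>x. u x * v x) = a * b / 4 * N (\<lambda>x. z 1 x + -1 * z (-1) x)"
    unfolding eq using u(3) v(3) by (subst N_scale) (intro B_add B_scale zB, simp)
  also have "\<dots> \<le> a * b / 4 * (N (z 1) + N (\<lambda>x. -1 * z (-1) x))"
    using u(3) v(3) by (intro mult_left_mono N_triangle B_scale zB) auto
  also have "\<dots> = a * b / 4 * (N (z 1) + N (z (-1)))"
    by (subst N_scale[OF zB]) simp
  also have "\<dots> \<le> a * b / 4 * (M * 4 + M * 4)"
    using u(3) v(3) by (intro mult_left_mono add_mono zN) auto
  finally show "N (\<lambda>x. u x * v x) \<le> 2 * M * a * b" by simp
qed

text \<open>Iterating the bound on squares controls all \<open>\<integral>\<bar>f\<bar>\<^bsup>2^k\<^esup>\<close>; letting \<open>k\<close> tend to infinity gives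
  an essential supremum bound.\<close>

lemma AE_le_N:
  assumes f: "f \<in> B"
  shows "AE x in \<mu>. \<bar>f x\<bar> \<le> M * N f"
proof -
  have [measurable]: "f \<in> borel_measurable \<mu>" by (rule B_measurable[OF f])
  define r where "r = M * N f"
  have "0 \<le> r" using M N_nonneg[OF f] by (simp add: r_def)
  \<comment> \<open>The leading \<open>M\<close> makes the bound on squares multiplicative: squaring
    a function at most squares \<open>M\<close> times its norm.\<close>
  have pow: "(\<lambda>x. f x ^ 2 ^ k) \<in> B \<and> M * N (\<lambda>x. f x ^ 2 ^ k) \<le> r ^ 2 ^ k" for k
  proof (induction k)
    case 0
    then show ?case using f by (simp add: r_def)
  next
    case (Suc k)
    let ?u = "\<lambda>x. f x ^ 2 ^ k"
    have eq: "(\<lambda>x. f x ^ 2 ^ Suc k) = (\<lambda>x. ?u x * ?u x)"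
      by (simp add: power_add[symmetric] mult_2)
    have u: "?u \<in> B" using Suc by simp
    have "M * N (\<lambda>x. ?u x * ?u x) \<le> M * (M * (N ?u * N ?u))"
      using N_square[OF u] M by (intro mult_left_mono) auto
    also have "\<dots> = (M * N ?u) * (M * N ?u)" by simp
    also have "\<dots> \<le> r ^ 2 ^ k * r ^ 2 ^ k"
      using Suc N_nonneg[OF u] M \<open>0 \<le> r\<close> by (intro mult_mono) auto
    finally show ?case unfolding eq using N_square[OF u] by (simp add: power_add[symmetric] mult_2)
  qed
  have "AE x in \<mu>. \<bar>f x\<bar> < r + e" if "0 < e" for e
  proof -
    let ?D = "{x \<in> space \<mu>. r + e \<le> \<bar>f x\<bar>}"
    \<comment> \<open>Markov's inequality for the power \<open>2 ^ k\<close>. Since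
      \<open>r / (r + e) < 1\<close>, the bound vanishes as \<open>k\<close> grows.\<close>
    have le: "measure \<mu> ?D \<le> c1 / M * (r / (r + e)) ^ 2 ^ k" for k
    proof -
      have i: "integrable \<mu> (\<lambda>x. f x ^ 2 ^ k)" using pow B_integrable by blast
      have "(r + e) ^ 2 ^ k * measure \<mu> ?D = (\<integral>x. (r + e) ^ 2 ^ k * indicator ?D x \<partial>\<mu>)"
        by simp
      also have "\<dots> \<le> (\<integral>x. \<bar>f x ^ 2 ^ k\<bar> \<partial>\<mu>)"
      proof (rule integral_mono)
        show "integrable \<mu> (\<lambda>x. (r + e) ^ 2 ^ k * indicator ?D x)"
          by (intro integrable_mult_right integrable_real_indicator) (auto simp: emeasure_eq_measure)
        show "integrable \<mu> (\<lambda>x. \<bar>f x ^ 2 ^ k\<bar>)" by (intro integrable_abs i)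
      qed (use \<open>0 \<le> r\<close> \<open>0 < e\<close> in \<open>auto simp: indicator_def power_abs intro!: power_mono\<close>)
      also have "\<dots> \<le> c1 * N (\<lambda>x. f x ^ 2 ^ k)" using pow L1_le_N by blast
      also have "\<dots> \<le> c1 * (r ^ 2 ^ k / M)"
        using pow[of k] M c1_nonneg by (intro mult_left_mono) (auto simp: field_simps)
      finally show ?thesis using \<open>0 \<le> r\<close> \<open>0 < e\<close> M by (simp add: field_simps)
    qed
    have "(\<lambda>k. c1 / M * (r / (r + e)) ^ 2 ^ k) \<longlonglongrightarrow> c1 / M * 0"
    proof (rule tendsto_mult[OF tendsto_const])
      have "(\<lambda>k. (r / (r + e)) ^ k) \<longlonglongrightarrow> 0"
        using \<open>0 \<le> r\<close> \<open>0 < e\<close> by (intro LIMSEQ_power_zero) simp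
      moreover have "strict_mono (\<lambda>k. 2 ^ k :: nat)" by (auto intro: strict_monoI)
      ultimately show "(\<lambda>k. (r / (r + e)) ^ 2 ^ k) \<longlonglongrightarrow> 0"
        using LIMSEQ_subseq_LIMSEQ[of "\<lambda>k. (r / (r + e)) ^ k" 0 "\<lambda>k. 2 ^ k"] by (simp add: o_def)
    qed
    then have "measure \<mu> ?D \<le> c1 / M * 0"
      by (rule LIMSEQ_le_const) (use le in blast)
    then have "measure \<mu> ?D = 0" by (simp add: measure_le_0_iff)
    then have "AE x in \<mu>. x \<notin> ?D"
      by (intro AE_not_in) (auto simp: null_sets_def emeasure_eq_measure)
    then show ?thesis by (auto elim: eventually_mono)
  qed
  \<comment> \<open>The exceptional null set depends on \<open>e\<close>, so \<open>e\<close> is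
    restricted to a countable sequence tending to 0.\<close>
  then have "AE x in \<mu>. \<forall>k. \<bar>f x\<bar> < r + inverse (real (Suc k))"
    by (subst AE_all_countable) simp
  then show ?thesis
  proof eventually_elim
    case (elim x)
    have "\<bar>f x\<bar> \<le> r"
    proof (rule field_le_epsilon)
      fix e :: real assume "0 < e"
      then obtain k where "inverse (real (Suc k)) < e" using reals_Archimedean by blast
      with elim[rule_format, of k] show "\<bar>f x\<bar> \<le> r + e" by simp
    qed
    then show ?case by (simp add: r_def)
  qed
qed

lemma integral_mult_funpow:
  assumes "u \<in> B" "g \<in> borel_measurable \<mu>" "AE x in \<mu>. \<bar>g x\<bar> \<le> t"
  shows "(\<integral>x. u x * g ((T ^^ n) x) \<partial>\<mu>) = (\<integral>x. (P ^^ n) u x * g x \<partial>\<mu>)"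
  using integral_perron_frobenius_funpow[OF T P B_integrable[OF assms(1)] assms(2,3)] by simp

text \<open>The constant in bounds that use no decay, where the constant 1 is the factor measured by
  \<open>N\<close>.\<close>

definition c0 where "c0 = C * N (\<lambda>_. 1)"

text \<open>A common constant for all correlation bounds: \<open>c0\<close> for the trivial ones,
  then two-point decay and the first, middle and last gap. Some powers of \<open>M\<close> pay for
  raising powers of \<open>N f / s\<close> to the cube.\<close>

definition E0 where "E0 = c0 + C * \<kappa> * (1 + M\<^sup>2 + M\<^sup>2 * L + 2 * M\<^sup>2 * L\<^sup>2)"

lemma c0_nonneg: "0 \<le> c0"
  using C N_nonneg[OF one_in_B] by (simp add: c0_def)

lemma E0_ge:
  shows "c0 \<le> E0" "C * \<kappa> \<le> E0" "C * \<kappa> * M\<^sup>2 \<le> E0" "C * \<kappa> * (M\<^sup>2 * L) \<le> E0"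
    "C * \<kappa> * (2 * M\<^sup>2 * L\<^sup>2) \<le> E0" "0 \<le> E0"
proof -
  have "0 \<le> C * \<kappa>" "0 \<le> C * \<kappa> * M\<^sup>2" "0 \<le> C * \<kappa> * (M\<^sup>2 * L)" "0 \<le> C * \<kappa> * (2 * M\<^sup>2 * L\<^sup>2)"
    using C \<kappa> L_pos by auto
  with c0_nonneg show "c0 \<le> E0" "C * \<kappa> \<le> E0" "C * \<kappa> * M\<^sup>2 \<le> E0" "C * \<kappa> * (M\<^sup>2 * L) \<le> E0"
    "C * \<kappa> * (2 * M\<^sup>2 * L\<^sup>2) \<le> E0" "0 \<le> E0"
    by (simp_all only: E0_def distrib_left mult_1_right)
qed

end


section \<open>Correlations of a centered observable\<close>

text \<open>Requiring \<open>s \<le> M * N f\<close> bounds \<open>N f / s\<close> from below, which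
  makes the three gap bounds comparable. Observables with \<open>N f = 0\<close> are treated
  separately.\<close>

locale centered_observable = spectral_gap_space \<mu> T P B N \<kappa> \<theta> C M p q
  for \<mu> :: "'a measure" and T P B N \<kappa> \<theta> C M p q +
  fixes f :: "'a \<Rightarrow> real" and s :: real
  assumes f: "f \<in> B" and mean_zero: "(\<integral>x. f x \<partial>\<mu>) = 0"
    and AE_le: "AE x in \<mu>. \<bar>f x\<bar> \<le> s"
    and N_pos: "0 < N f" and s: "0 < s" "s \<le> M * N f"
begin

lemma f_measurable [measurable]: "f \<in> borel_measurable \<mu>"
  by (rule B_measurable[OF f])

lemma T_measurable [measurable]: "T ^^ i \<in> measurable \<mu> \<mu>"
  using measure_preserving_funpow[OF T] by (simp add: measure_preserving_def)

definition Q where "Q = Lr_norm \<mu> q f"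

lemma f_in_Lq: "f \<in> Lr_space \<mu> q"
  by (rule AE_bounded_imp_Lr[OF f_measurable AE_le q])

lemma Q_nonneg: "0 \<le> Q"
  unfolding Q_def
proof (rule Lr_norm_nonneg)
  show "f \<in> Lr_space \<mu> \<infinity>" if "q = \<infinity>" using f_in_Lq that by simp
qed

lemma AE_le_funpow: "AE x in \<mu>. \<bar>f ((T ^^ i) x)\<bar> \<le> s"
  using AE_measure_preserving[OF measure_preserving_funpow[OF T], OF AE_le] .

section \<open>Hoelder and decoupling estimates\<close>

text \<open>A single factor \<open>f\<close> is paired with \<open>u\<close> by Hoelder and yields
  \<open>Q\<close>; the remaining factors go into \<open>w\<close> and cost only an essential
  bound.\<close>

lemma abs_integral_mult_le:
  assumes u: "u \<in> B" and [measurable]: "w \<in> borel_measurable \<mu>"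
    and w: "AE x in \<mu>. \<bar>w x\<bar> \<le> t"
  shows "integrable \<mu> (\<lambda>x. u x * (f x * w x))"
    and "\<bar>\<integral>x. u x * (f x * w x) \<partial>\<mu>\<bar> \<le> t * (C * N u * Q)"
proof -
  have [measurable]: "u \<in> borel_measurable \<mu>" by (rule B_measurable[OF u])
  have i: "integrable \<mu> (\<lambda>x. t * \<bar>u x * f x\<bar>)"
    using B_Holder(1)[OF u f_in_Lq] by simp
  have le: "AE x in \<mu>. \<bar>u x * (f x * w x)\<bar> \<le> t * \<bar>u x * f x\<bar>"
    using w
  proof eventually_elim
    case (elim x)
    have "\<bar>u x * f x\<bar> * \<bar>w x\<bar> \<le> \<bar>u x * f x\<bar> * t" using elim by (intro mult_left_mono) auto
    then show ?case by (simp add: abs_mult mult_ac)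
  qed
  show i': "integrable \<mu> (\<lambda>x. u x * (f x * w x))"
    using le by (intro Bochner_Integration.integrable_bound[OF i]) (auto elim: eventually_mono)
  have "AE x in \<mu>. 0 \<le> t" using w by eventually_elim linarith
  then have "0 \<le> t" by simp
  have "\<bar>\<integral>x. u x * (f x * w x) \<partial>\<mu>\<bar> \<le> (\<integral>x. \<bar>u x * (f x * w x)\<bar> \<partial>\<mu>)"
    by (rule integral_abs_bound)
  also have "\<dots> \<le> (\<integral>x. t * \<bar>u x * f x\<bar> \<partial>\<mu>)"
    using le i i' by (intro integral_mono_AE) auto
  also have "\<dots> = t * (\<integral>x. \<bar>u x * f x\<bar> \<partial>\<mu>)" by simp
  also have "\<dots> \<le> t * (C * N u * Q)"
    unfolding Q_def by (intro mult_left_mono B_Holder f_in_Lq u \<open>0 \<le> t\<close>)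
  finally show "\<bar>\<integral>x. u x * (f x * w x) \<partial>\<mu>\<bar> \<le> t * (C * N u * Q)" .
qed

text \<open>Duality moves \<open>T ^^ n\<close> onto \<open>u\<close>. Subtracting the mean of
  \<open>u\<close> leaves the function whose norm the spectral gap controls.\<close>

lemma decoupling_le:
  assumes u: "u \<in> B" and [measurable]: "w \<in> borel_measurable \<mu>"
    and w: "AE x in \<mu>. \<bar>w x\<bar> \<le> t"
  shows "\<bar>(\<integral>x. u x * (f ((T ^^ n) x) * w ((T ^^ n) x)) \<partial>\<mu>) - (\<integral>x. u x \<partial>\<mu>) * (\<integral>x. f x * w x \<partial>\<mu>)\<bar>
    \<le> t * (C * (\<kappa> * \<theta> ^ n * N u) * Q)"
proof -
  define e where "e = (\<integral>x. u x \<partial>\<mu>)"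
  have "AE x in \<mu>. 0 \<le> t" using w by eventually_elim linarith
  then have "0 \<le> t" by simp
  have "AE x in \<mu>. \<bar>f x * w x\<bar> \<le> s * t"
    using AE_le w by eventually_elim (use s in \<open>auto simp: abs_mult intro: mult_mono\<close>)
  then have "(\<integral>x. u x * (f ((T ^^ n) x) * w ((T ^^ n) x)) \<partial>\<mu>) = (\<integral>x. (P ^^ n) u x * (f x * w x) \<partial>\<mu>)"
    by (intro integral_mult_funpow[OF u, of "\<lambda>x. f x * w x"]) auto
  moreover have "(\<integral>x. ((P ^^ n) u x - e) * (f x * w x) \<partial>\<mu>)
      = (\<integral>x. (P ^^ n) u x * (f x * w x) \<partial>\<mu>) - e * (\<integral>x. f x * w x \<partial>\<mu>)"
    using abs_integral_mult_le(1)[OF B_funpow[OF u] assms(2) w, of n]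
      abs_integral_mult_le(1)[OF one_in_B assms(2) w]
    by (simp add: left_diff_distrib)
  moreover have "\<bar>\<integral>x. ((P ^^ n) u x - e) * (f x * w x) \<partial>\<mu>\<bar> \<le> t * (C * N (\<lambda>x. (P ^^ n) u x - e) * Q)"
    by (intro abs_integral_mult_le B_diff_const B_funpow u assms(2) w)
  moreover have "\<dots> \<le> t * (C * (\<kappa> * \<theta> ^ n * N u) * Q)"
    unfolding e_def using C \<open>0 \<le> t\<close>
    by (intro mult_left_mono mult_right_mono gap u Q_nonneg) auto
  ultimately show ?thesis by (simp add: e_def)
qed

section \<open>Two-point and four-point correlations\<close>

definition corr4 where
  "corr4 i j k = (\<integral>x. f x * f ((T ^^ i) x) * f ((T ^^ (i + j)) x) * f ((T ^^ (i + j + k)) x) \<partial>\<mu>)"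

definition corr2 where "corr2 i = (\<integral>x. f x * f ((T ^^ i) x) \<partial>\<mu>)"

lemma funpow_shift: "(T ^^ (i + j)) x = (T ^^ j) ((T ^^ i) x)"
  by (subst add.commute) (simp add: funpow_add)

lemma AE_le_mult2: "AE x in \<mu>. \<bar>f ((T ^^ i) x) * f ((T ^^ j) x)\<bar> \<le> s ^ 2"
  using AE_le_funpow[of i] AE_le_funpow[of j]
  by eventually_elim (use s in \<open>auto simp: abs_mult power2_eq_square intro: mult_mono\<close>)

lemma AE_le_mult3: "AE x in \<mu>. \<bar>f ((T ^^ i) x) * f ((T ^^ j) x) * f ((T ^^ k) x)\<bar> \<le> s ^ 3"
  using AE_le_mult2[of i j] AE_le_funpow[of k]
proof eventually_elim
  case (elim x)
  have "\<bar>f ((T ^^ i) x) * f ((T ^^ j) x)\<bar> * \<bar>f ((T ^^ k) x)\<bar> \<le> s ^ 2 * s"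
    using elim s by (intro mult_mono) auto
  then show ?case by (simp add: abs_mult power3_eq_cube power2_eq_square)
qed

lemma corr4_le: "\<bar>corr4 i j k\<bar> \<le> c0 * Q * s ^ 3"
  using abs_integral_mult_le(2)[OF one_in_B _ AE_le_mult3[of i "i + j" "i + j + k"]]
  by (simp add: corr4_def c0_def mult_ac)

lemma corr2_le: "\<bar>corr2 i\<bar> \<le> c0 * Q * s"
  using abs_integral_mult_le(2)[OF one_in_B _ AE_le_funpow[of i]]
  by (simp add: corr2_def c0_def mult_ac)

lemma corr2_decay: "\<bar>corr2 i\<bar> \<le> C * \<kappa> * \<theta> ^ i * N f * Q"
  using decoupling_le[OF f, of "\<lambda>_. 1" 1 i] by (simp add: corr2_def mean_zero mult_ac)

text \<open>Decoupling with \<open>u = f\<close>, whose zero mean removes the product term. The last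
  two factors form \<open>w\<close>, hence \<open>s ^ 2\<close>.\<close>

lemma corr4_first_gap: "\<bar>corr4 i j k\<bar> \<le> C * \<kappa> * \<theta> ^ i * N f * Q * s ^ 2"
  using decoupling_le[OF f _ AE_le_mult2[of j "j + k"], of i]
  by (simp add: corr4_def mean_zero funpow_shift[symmetric] mult_ac add_ac)

text \<open>Absorbs the first gap: by duality \<open>corr4\<close> becomes a correlation of
  \<open>g i\<close> with the two remaining factors.\<close>

definition g where "g i x = f x * (P ^^ i) f x"

lemma g_in_B: "g i \<in> B"
  unfolding g_def using mult_funpow[OF f] by blast

lemma N_g_le: "N (g i) \<le> M * L * N f ^ 2"
proof -
  have "N (g i) \<le> M * N f * N ((P ^^ i) f)" unfolding g_def using mult_funpow[OF f] by blast
  also have "\<dots> \<le> M * N f * (L * N f)"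
    using M N_pos by (intro mult_left_mono N_funpow_le f) auto
  finally show ?thesis by (simp add: power2_eq_square mult_ac)
qed

lemma integral_g: "(\<integral>x. g i x \<partial>\<mu>) = corr2 i"
  using integral_mult_funpow[OF f f_measurable AE_le, of i]
  by (simp add: g_def corr2_def mult.commute)

lemma corr4_eq_g:
  "corr4 i j k = (\<integral>x. g i x * (f ((T ^^ j) x) * f ((T ^^ (j + k)) x)) \<partial>\<mu>)"
proof -
  have "corr4 i j k = (\<integral>x. f x * (f ((T ^^ i) x) * f ((T ^^ j) ((T ^^ i) x)) * f ((T ^^ (j + k)) ((T ^^ i) x))) \<partial>\<mu>)"
    by (simp add: corr4_def funpow_shift[symmetric] mult_ac add_ac)
  also have "\<dots> = (\<integral>x. (P ^^ i) f x * (f x * f ((T ^^ j) x) * f ((T ^^ (j + k)) x)) \<partial>\<mu>)"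
    using AE_le_mult3[of 0 j "j + k"]
    by (intro integral_mult_funpow[OF f, of "\<lambda>x. f x * f ((T ^^ j) x) * f ((T ^^ (j + k)) x)"]) auto
  finally show ?thesis by (simp add: g_def mult_ac)
qed

text \<open>Decoupling with \<open>u = g i\<close>. Neither mean need vanish: they are the
  correlations within the first and the last pair, so their product is subtracted.\<close>

lemma corr4_middle_gap:
  "\<bar>corr4 i j k - corr2 i * corr2 k\<bar> \<le> C * \<kappa> * (M * L) * \<theta> ^ j * N f ^ 2 * Q * s"
proof -
  have "\<bar>corr4 i j k - corr2 i * corr2 k\<bar> \<le> s * (C * (\<kappa> * \<theta> ^ j * N (g i)) * Q)"
    using decoupling_le[OF g_in_B[of i] _ AE_le_funpow[of k], of j]
    by (simp add: integral_g corr4_eq_g funpow_shift corr2_def)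
  also have "\<dots> \<le> s * (C * (\<kappa> * \<theta> ^ j * (M * L * N f ^ 2)) * Q)"
    using C \<kappa> \<theta> s by (intro mult_left_mono mult_right_mono N_g_le Q_nonneg) auto
  finally show ?thesis by (simp add: mult_ac)
qed

text \<open>A second transfer absorbs the middle gap into \<open>h\<close>. The last factor then
  stands alone, and its zero mean removes the product term.\<close>

lemma corr4_last_gap:
  "\<bar>corr4 i j k\<bar> \<le> C * \<kappa> * (2 * M\<^sup>2 * L\<^sup>2) * \<theta> ^ k * N f ^ 3 * Q"
proof -
  define h where "h x = f x * (P ^^ j) (g i) x" for x
  have "N ((P ^^ j) (g i)) \<le> L * N (g i)" by (rule N_funpow_le[OF g_in_B])
  also have "\<dots> \<le> L * (M * L * N f ^ 2)" using L_pos by (intro mult_left_mono N_g_le) auto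
  finally have "N ((P ^^ j) (g i)) \<le> L * (M * L * N f ^ 2)" .
  \<comment> \<open>Two different functions are multiplied, so the polarized bound is used. It asks
    for positive bounds, which the explicit one provides even if the norm itself vanishes.\<close>
  note h = N_mult_le[OF f order_refl N_pos B_funpow[OF g_in_B] this]
  have pos: "0 < L * (M * L * N f ^ 2)" using L_pos M N_pos by simp
  have hB: "h \<in> B" and hN: "N h \<le> 2 * M * N f * (L * (M * L * N f ^ 2))"
    unfolding h_def using h pos by auto
  have "corr4 i j k = (\<integral>x. g i x * (f ((T ^^ j) x) * f ((T ^^ k) ((T ^^ j) x))) \<partial>\<mu>)"
    by (simp add: corr4_eq_g funpow_shift)
  also have "\<dots> = (\<integral>x. (P ^^ j) (g i) x * (f x * f ((T ^^ k) x)) \<partial>\<mu>)"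
    using AE_le_mult2[of 0 k]
    by (intro integral_mult_funpow[OF g_in_B, of "\<lambda>x. f x * f ((T ^^ k) x)"]) auto
  also have "\<dots> = (\<integral>x. h x * f ((T ^^ k) x) \<partial>\<mu>)" by (simp add: h_def mult_ac)
  finally have "\<bar>corr4 i j k\<bar> \<le> C * (\<kappa> * \<theta> ^ k * N h) * Q"
    using decoupling_le[OF hB, of "\<lambda>_. 1" 1 k] by (simp add: mean_zero)
  also have "\<dots> \<le> C * (\<kappa> * \<theta> ^ k * (2 * M * N f * (L * (M * L * N f ^ 2)))) * Q"
    using C \<kappa> \<theta> by (intro mult_left_mono mult_right_mono hN Q_nonneg) auto
  finally show ?thesis by (simp add: mult_ac power2_eq_square power3_eq_cube)
qed

section \<open>Summation over the gaps\<close>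

definition y where "y = N f / s"

text \<open>The share of one gap in the geometric mean: the cap 1 is the trivial bound, and the cube
  root arises from spreading the decay over three gaps.\<close>

definition \<psi> where "\<psi> i = min 1 (root 3 \<theta> ^ i * y)"

lemma \<psi>_nonneg: "0 \<le> \<psi> i"
  using \<theta> N_pos s by (simp add: \<psi>_def y_def)

lemma y: "0 < y" "1 \<le> M * y" "N f = y * s"
  using N_pos s by (simp_all add: y_def)

text \<open>With a single gap the full rate \<open>\<theta>\<close> is available; it is weakened to
  its cube root so that the same \<open>\<psi>\<close> serves.\<close>

lemma corr2_le_\<psi>: "\<bar>corr2 i\<bar> \<le> E0 * Q * s * \<psi> i"
proof (cases "1 \<le> root 3 \<theta> ^ i * y")
  case True
  have "\<bar>corr2 i\<bar> \<le> c0 * (Q * s)" using corr2_le by (simp add: mult.assoc)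
  also have "\<dots> \<le> E0 * (Q * s)" using E0_ge(1) Q_nonneg s by (intro mult_right_mono) auto
  finally show ?thesis using True by (simp add: \<psi>_def)
next
  case False
  have "\<theta> \<le> root 3 \<theta>"
    using power_decreasing[of 1 3 "root 3 \<theta>"] \<theta> by (simp add: real_root_pow_pos2)
  then have le: "\<theta> ^ i \<le> root 3 \<theta> ^ i" using \<theta> by (intro power_mono) auto
  have "\<bar>corr2 i\<bar> \<le> C * \<kappa> * (\<theta> ^ i * (y * s * Q))"
    using corr2_decay[of i] y by (simp add: mult_ac)
  also have "\<dots> \<le> E0 * (root 3 \<theta> ^ i * (y * s * Q))"
    using E0_ge \<theta> le y s Q_nonneg by (intro mult_mono) auto
  finally show ?thesis using False by (simp add: \<psi>_def mult_ac)
qed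

text \<open>The excess over the product of two-point correlations decays in all three gaps. That
  product decays only in the first and last.\<close>

lemma corr4_le_\<psi>:
  "\<bar>corr4 i j k\<bar> \<le> E0 * Q * s ^ 3 * (\<psi> i * \<psi> j * \<psi> k) + (E0 * Q * s)\<^sup>2 * (\<psi> i * \<psi> k)"
proof -
  let ?W = "Q * s ^ 3"
  have W: "0 \<le> ?W" using Q_nonneg s by simp
  define R where "R = \<bar>corr2 i * corr2 k\<bar>"
  \<comment> \<open>As \<open>z\<close> is at most both the absolute correlation and its distance to
    the product, it inherits the bounds of all three gaps.\<close>
  define z where "z = \<bar>corr4 i j k\<bar> - R"
  have "0 \<le> R" by (simp add: R_def)
  \<comment> \<open>Since \<open>1 \<le> M * y\<close>, lower powers of \<open>y\<close> are raised
    to the cube at the price of factors \<open>M\<close>.\<close>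
  have y1: "y \<le> M\<^sup>2 * y ^ 3"
  proof -
    have "y * 1 \<le> y * (M * y)\<^sup>2" using y by (intro mult_left_mono) (auto intro: one_le_power)
    then show ?thesis by (simp add: power_mult_distrib power2_eq_square power3_eq_cube mult_ac)
  qed
  have y2: "y\<^sup>2 \<le> M * y ^ 3"
  proof -
    have "y\<^sup>2 * 1 \<le> y\<^sup>2 * (M * y)" using y by (intro mult_left_mono) auto
    then show ?thesis by (simp add: power2_eq_square power3_eq_cube mult_ac)
  qed
  have E: "a * ?W \<le> E0 * ?W" if "a \<le> E0" for a using that W by (rule mult_right_mono)
  have z0: "z \<le> c0 * ?W" using corr4_le[of i j k] \<open>0 \<le> R\<close> by (simp add: z_def mult_ac)
  have "root 3 \<theta> ^ 3 = \<theta>" using \<theta> by simp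
  \<comment> \<open>The data common to the three gaps are fixed; the decaying bound and its constant
    remain open.\<close>
  note cube = le_mult_cube_min_one[OF z0 _ E[OF E0_ge(1)] _ less_imp_le[OF y(1)] less_imp_le[OF \<theta>(1)] this,
      folded \<psi>_def]
  have "z \<le> C * \<kappa> * \<theta> ^ i * (y * s) * Q * s ^ 2"
    using corr4_first_gap[of i j k] \<open>0 \<le> R\<close> y by (simp add: z_def)
  also have "\<dots> = C * \<kappa> * \<theta> ^ i * ?W * y" by (simp add: power2_eq_square power3_eq_cube mult_ac)
  also have "\<dots> \<le> C * \<kappa> * \<theta> ^ i * ?W * (M\<^sup>2 * y ^ 3)"
    using C \<kappa> \<theta> W by (intro mult_left_mono y1) auto
  finally have 1: "z \<le> E0 * ?W * \<psi> i ^ 3"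
    by (intro cube[OF _ E[OF E0_ge(3)]]) (simp add: mult_ac)
  have "z \<le> C * \<kappa> * (M * L) * \<theta> ^ j * (y * s) ^ 2 * Q * s"
    using corr4_middle_gap[of i j k] y by (simp add: z_def R_def)
  also have "\<dots> = C * \<kappa> * (M * L) * \<theta> ^ j * ?W * y\<^sup>2"
    by (simp add: power2_eq_square power3_eq_cube mult_ac)
  also have "\<dots> \<le> C * \<kappa> * (M * L) * \<theta> ^ j * ?W * (M * y ^ 3)"
    using C \<kappa> \<theta> W M L_pos by (intro mult_left_mono y2) auto
  finally have 2: "z \<le> E0 * ?W * \<psi> j ^ 3"
    by (intro cube[OF _ E[OF E0_ge(4)]]) (simp add: power2_eq_square mult_ac)
  have "z \<le> C * \<kappa> * (2 * M\<^sup>2 * L\<^sup>2) * \<theta> ^ k * (y * s) ^ 3 * Q"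
    using corr4_last_gap[of i j k] \<open>0 \<le> R\<close> y by (simp add: z_def)
  then have 3: "z \<le> E0 * ?W * \<psi> k ^ 3"
    by (intro cube[OF _ E[OF E0_ge(5)]]) (simp add: power_mult_distrib mult_ac)
  have "z \<le> E0 * ?W * (\<psi> i * \<psi> j * \<psi> k)"
    using W E0_ge(6) by (intro le_mult_of_le_cubes[OF 1 2 3] \<psi>_nonneg) auto
  moreover have "R \<le> (E0 * Q * s * \<psi> i) * (E0 * Q * s * \<psi> k)"
    unfolding R_def abs_mult using Q_nonneg s E0_ge(6) \<psi>_nonneg
    by (intro mult_mono corr2_le_\<psi>) auto
  ultimately show ?thesis by (simp add: z_def power2_eq_square mult_ac)
qed

lemma sum_\<psi>_le: "(\<Sum>i<n. \<psi> i) \<le> 2 / (1 - root 3 \<theta>) * ln (1 + y)"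
  unfolding \<psi>_def using \<theta> y by (intro sum_min_one_geometric_le) auto

text \<open>The sums factor. The middle gap is absent from \<open>\<psi> i * \<psi> k\<close>, so
  its free sum gives the extra factor \<open>n\<close>.\<close>

lemma sum_corr4_le:
  defines "S \<equiv> \<lambda>n. s * (\<Sum>i<n. \<psi> i)"
  shows "(\<Sum>i<n. \<Sum>j<n. \<Sum>k<n. \<bar>corr4 i j k\<bar>) \<le> E0 * Q * S n ^ 3 + real n * (E0 * Q * S n)\<^sup>2"
proof -
  have "(\<Sum>i<n. \<Sum>j<n. \<Sum>k<n. \<bar>corr4 i j k\<bar>) \<le> (\<Sum>i<n. \<Sum>j<n. \<Sum>k<n.
      E0 * Q * s ^ 3 * (\<psi> i * \<psi> j * \<psi> k) + (E0 * Q * s)\<^sup>2 * (\<psi> i * \<psi> k))"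
    by (intro sum_mono corr4_le_\<psi>)
  also have "\<dots> = E0 * Q * s ^ 3 * (\<Sum>i<n. \<Sum>j<n. \<Sum>k<n. \<psi> i * \<psi> j * \<psi> k)
      + (E0 * Q * s)\<^sup>2 * (\<Sum>i<n. \<Sum>j<n. \<Sum>k<n. \<psi> i * \<psi> k)"
    by (simp only: sum.distrib sum_distrib_left)
  also have "(\<Sum>i<n. \<Sum>j<n. \<Sum>k<n. \<psi> i * \<psi> j * \<psi> k) = (\<Sum>i<n. \<psi> i) ^ 3"
    by (simp only: sum_distrib_left[symmetric] sum_distrib_right[symmetric] power3_eq_cube)
  also have "(\<Sum>i<n. \<Sum>j<n. \<Sum>k<n. \<psi> i * \<psi> k) = real n * (\<Sum>i<n. \<psi> i) ^ 2"
    by (simp add: sum_distrib_left[symmetric] sum_distrib_right[symmetric] power2_eq_square)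
  finally show ?thesis
    by (simp add: S_def power_mult_distrib mult_ac)
qed

section \<open>The fourth moment\<close>

lemma fourth_moment_le:
  "(\<integral>x. (\<Sum>i=1..n. f ((T ^^ i) x)) ^ 4 \<partial>\<mu>) \<le> 24 * (real n * (\<Sum>i<n. \<Sum>j<n. \<Sum>k<n. \<bar>corr4 i j k\<bar>))"
proof -
  let ?F = "\<lambda>a b c d x. f ((T ^^ a) x) * f ((T ^^ b) x) * f ((T ^^ c) x) * f ((T ^^ d) x)"
  have i: "integrable \<mu> (?F a b c d)" for a b c d
  proof (rule integrable_const_bound)
    show "AE x in \<mu>. norm (?F a b c d x) \<le> s ^ 3 * s"
      using AE_le_mult3[of a b c] AE_le_funpow[of d]
    proof eventually_elim
      case (elim x)
      then have "\<bar>f ((T ^^ a) x) * f ((T ^^ b) x) * f ((T ^^ c) x)\<bar> * \<bar>f ((T ^^ d) x)\<bar> \<le> s ^ 3 * s"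
        using s by (intro mult_mono) auto
      then show ?case by (simp add: abs_mult)
    qed
  qed simp
  let ?G = "\<lambda>a b c d. \<bar>\<integral>x. ?F a b c d x \<partial>\<mu>\<bar>"
  \<comment> \<open>Stationarity: invariance under \<open>T ^^ a\<close> moves the smallest index to
    0.\<close>
  have shift: "?G a (a + i) (a + i + j) (a + i + j + k) = \<bar>corr4 i j k\<bar>" for a i j k
    using integral_measure_preserving[OF measure_preserving_funpow[OF T, of a], of "?F 0 i (i + j) (i + j + k)"]
    by (simp add: corr4_def funpow_shift[symmetric] add.assoc)
  have "(\<integral>x. (\<Sum>i=1..n. f ((T ^^ i) x)) ^ 4 \<partial>\<mu>)
      = (\<Sum>a=1..n. \<Sum>b=1..n. \<Sum>c=1..n. \<Sum>d=1..n. \<integral>x. ?F a b c d x \<partial>\<mu>)"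
    using i by (simp add: power4_sum_eq)
  also have "\<dots> \<le> (\<Sum>a=1..n. \<Sum>b=1..n. \<Sum>c=1..n. \<Sum>d=1..n. ?G a b c d)"
    by (intro sum_mono) simp
  also have "\<dots> \<le> 24 * (\<Sum>a=1..n. \<Sum>b=1..n. \<Sum>c=1..n. \<Sum>d=1..n.
      if a \<le> b \<and> b \<le> c \<and> c \<le> d then ?G a b c d else 0)"
    by (rule sum4_le_sorted) (simp_all add: mult_ac)
  also have "\<dots> \<le> 24 * (real n * (\<Sum>i<n. \<Sum>j<n. \<Sum>k<n. \<bar>corr4 i j k\<bar>))"
    by (intro mult_left_mono sum4_sorted_le_gaps shift) auto
  finally show ?thesis .
qed

lemma fourth_moment_bound:
  assumes m: "s \<le> m" "1 \<le> m"
  defines "D \<equiv> 2 / (1 - root 3 \<theta>)"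
  shows "(\<integral>x. (\<Sum>i=1..n. f ((T ^^ i) x)) ^ 4 \<partial>\<mu>)
    \<le> 24 * (E0 * D ^ 3 + E0\<^sup>2 * D\<^sup>2) * m ^ 3 *
      (real n * Q * ln (N f + 1) ^ 3 + (real n)\<^sup>2 * Q\<^sup>2 * (ln (N f + 1))\<^sup>2)"
proof -
  define l where "l = ln (N f + 1)"
  define S where "S = s * (\<Sum>i<n. \<psi> i)"
  have "0 \<le> S" using s \<psi>_nonneg by (auto simp: S_def intro!: mult_nonneg_nonneg sum_nonneg)
  have "0 \<le> l" using N_pos by (simp add: l_def)
  have "0 < D" using \<theta> by (simp add: D_def)
  have "S \<le> s * (D * ln (1 + y))"
    unfolding S_def D_def using s by (intro mult_left_mono sum_\<psi>_le) auto
  also have "\<dots> = D * (s * ln (1 + N f / s))" by (simp add: y_def)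
  also have "\<dots> \<le> D * (m * l)"
    unfolding l_def using \<open>0 < D\<close> s m N_pos by (intro mult_left_mono mult_ln_one_add_divide_mono) auto
  finally have S: "S \<le> D * m * l" by simp
  \<comment> \<open>The quadratic term carries only \<open>m\<^sup>2\<close>;
    \<open>1 \<le> m\<close> brings it under the common factor \<open>m ^ 3\<close>.\<close>
  have m23: "m\<^sup>2 \<le> m ^ 3" using m by (intro power_increasing) auto
  have "S ^ 3 \<le> (D * m * l) ^ 3" using S \<open>0 \<le> S\<close> by (intro power_mono)
  then have 1: "E0 * Q * S ^ 3 \<le> E0 * Q * (D * m * l) ^ 3"
    using E0_ge(6) Q_nonneg by (intro mult_left_mono) auto
  have "S\<^sup>2 \<le> (D * m * l)\<^sup>2" using S \<open>0 \<le> S\<close> by (intro power_mono)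
  also have "\<dots> = (D * l)\<^sup>2 * m\<^sup>2" by (simp add: power_mult_distrib mult_ac)
  also have "\<dots> \<le> (D * l)\<^sup>2 * m ^ 3" by (intro mult_left_mono m23) auto
  finally have 2: "(E0 * Q)\<^sup>2 * S\<^sup>2 \<le> (E0 * Q)\<^sup>2 * ((D * l)\<^sup>2 * m ^ 3)"
    by (intro mult_left_mono) auto
  define X where "X = real n * Q * l ^ 3"
  define Y where "Y = (real n)\<^sup>2 * Q\<^sup>2 * l\<^sup>2"
  have XY: "0 \<le> X" "0 \<le> Y" using Q_nonneg \<open>0 \<le> l\<close> by (auto simp: X_def Y_def)
  have "(\<integral>x. (\<Sum>i=1..n. f ((T ^^ i) x)) ^ 4 \<partial>\<mu>)
      \<le> 24 * (real n * (E0 * Q * S ^ 3 + real n * ((E0 * Q)\<^sup>2 * S\<^sup>2)))"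
  proof (rule order_trans[OF fourth_moment_le], intro mult_left_mono)
    show "(\<Sum>i<n. \<Sum>j<n. \<Sum>k<n. \<bar>corr4 i j k\<bar>)
        \<le> E0 * Q * S ^ 3 + real n * ((E0 * Q)\<^sup>2 * S\<^sup>2)"
      using sum_corr4_le[of n] by (simp add: S_def power_mult_distrib)
  qed auto
  also have "\<dots> \<le> 24 * (real n * (E0 * Q * (D * m * l) ^ 3 + real n * ((E0 * Q)\<^sup>2 * ((D * l)\<^sup>2 * m ^ 3))))"
    by (intro 1 2 mult_left_mono add_mono) auto
  also have "\<dots> = 24 * m ^ 3 * (E0 * D ^ 3 * X + E0\<^sup>2 * D\<^sup>2 * Y)"
    by (simp add: X_def Y_def algebra_simps power_mult_distrib power2_eq_square)
  \<comment> \<open>The added cross terms are nonnegative and merge both coefficients into one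
    constant.\<close>
  also have "\<dots> \<le> 24 * m ^ 3 * ((E0 * D ^ 3 + E0\<^sup>2 * D\<^sup>2) * (X + Y))"
    using m XY E0_ge(6) \<open>0 < D\<close> by (intro mult_left_mono) (auto simp: algebra_simps)
  finally show ?thesis by (simp only: X_def Y_def l_def mult_ac)
qed

end

section \<open>Uniformity over all bounded centered observables\<close>

context spectral_gap_space
begin

lemma fourth_moment_inequality:
  "\<exists>K::real. \<forall>f\<in>B. \<forall>n\<ge>1.
    bounded (f ` space \<mu>) \<longrightarrow> (\<integral>x. f x \<partial>\<mu>) = 0 \<longrightarrow>
    (let m = max 1 (SUP x\<in>space \<mu>. \<bar>f x\<bar>) in
      (\<integral>x. (\<Sum>i=1..n. f ((T ^^ i) x)) ^ 4 \<partial>\<mu>)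
        \<le> K * m ^ 3 *
           (real n * Lr_norm \<mu> q f * (ln (N f + 1)) ^ 3
            + (real n)\<^sup>2 * (Lr_norm \<mu> q f)\<^sup>2 * (ln (N f + 1))\<^sup>2))"
proof (intro exI ballI allI impI)
  define K where "K = 24 * (E0 * (2 / (1 - root 3 \<theta>)) ^ 3 + E0\<^sup>2 * (2 / (1 - root 3 \<theta>))\<^sup>2)"
  fix f and n :: nat
  assume f: "f \<in> B" and bdd: "bounded (f ` space \<mu>)" and mean_zero: "(\<integral>x. f x \<partial>\<mu>) = 0"
  define m where "m = max 1 (SUP x\<in>space \<mu>. \<bar>f x\<bar>)"
  have [measurable]: "f \<in> borel_measurable \<mu>" by (rule B_measurable[OF f])
  from bdd have "bdd_above ((\<lambda>x. \<bar>f x\<bar>) ` space \<mu>)"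
    by (auto simp: bounded_iff bdd_above_def)
  then have f_le: "\<bar>f x\<bar> \<le> m" if "x \<in> space \<mu>" for x
    using cSUP_upper[OF that] by (fastforce simp: m_def)
  have "(\<integral>x. (\<Sum>i=1..n. f ((T ^^ i) x)) ^ 4 \<partial>\<mu>)
        \<le> K * m ^ 3 *
           (real n * Lr_norm \<mu> q f * (ln (N f + 1)) ^ 3
            + (real n)\<^sup>2 * (Lr_norm \<mu> q f)\<^sup>2 * (ln (N f + 1))\<^sup>2)"
  proof (cases "N f = 0")
    case True
    \<comment> \<open>If \<open>N f = 0\<close>, all iterates vanish almost everywhere and both
      sides are 0, since \<open>ln 1 = 0\<close>.\<close>
    have "AE x in \<mu>. f x = 0"
      using AE_le_N[OF f] True by (auto elim: eventually_mono)
    then have "AE x in \<mu>. f ((T ^^ i) x) = 0" for i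
      by (rule AE_measure_preserving[OF measure_preserving_funpow[OF T]])
    then have "AE x in \<mu>. \<forall>i. f ((T ^^ i) x) = 0" by (simp add: AE_all_countable)
    then have "AE x in \<mu>. (\<Sum>i=1..n. f ((T ^^ i) x)) ^ 4 = 0"
      by eventually_elim simp
    then have "(\<integral>x. (\<Sum>i=1..n. f ((T ^^ i) x)) ^ 4 \<partial>\<mu>) = 0"
      by (rule integral_eq_zero_AE)
    with True show ?thesis by simp
  next
    case False
    then have "0 < N f" using N_nonneg[OF f] by simp
    \<comment> \<open>Both terms are essential bounds. Their minimum meets \<open>s \<le> m\<close>,
      needed for the logarithm, and \<open>s \<le> M * N f\<close>, needed to compare the
      gaps.\<close>
    define s where "s = min m (M * N f)"
    have "0 < s" using \<open>0 < N f\<close> M by (simp add: s_def m_def)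
    have "AE x in \<mu>. \<bar>f x\<bar> \<le> m" using f_le by (intro AE_I2)
    then have "AE x in \<mu>. \<bar>f x\<bar> \<le> s"
      using AE_le_N[OF f] by eventually_elim (simp add: s_def)
    then interpret centered_observable \<mu> T P B N \<kappa> \<theta> C M p q f s
      using f mean_zero \<open>0 < N f\<close> \<open>0 < s\<close> by unfold_locales (auto simp: s_def)
    show ?thesis
      using fourth_moment_bound[of m n] by (simp add: K_def Q_def s_def m_def)
  qed
  then show "let m = max 1 (SUP x\<in>space \<mu>. \<bar>f x\<bar>) in
      (\<integral>x. (\<Sum>i=1..n. f ((T ^^ i) x)) ^ 4 \<partial>\<mu>)
        \<le> K * m ^ 3 *
           (real n * Lr_norm \<mu> q f * (ln (N f + 1)) ^ 3
            + (real n)\<^sup>2 * (Lr_norm \<mu> q f)\<^sup>2 * (ln (N f + 1))\<^sup>2)"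
    by (simp add: m_def)
qed

end

theorem theorem4:
  fixes \<mu> :: "'a measure"
    and T :: "'a \<Rightarrow> 'a"
    and P :: "('a \<Rightarrow> real) \<Rightarrow> ('a \<Rightarrow> real)"
    and B :: "('a \<Rightarrow> real) set"
    and N :: "('a \<Rightarrow> real) \<Rightarrow> real"
    and \<kappa> \<theta> C M :: real
    and p q :: ereal
  assumes "prob_space \<mu>"
    and "measure_preserving \<mu> T"
    and "perron_frobenius \<mu> T P"
    and "banach_function_space \<mu> B N"
    and "(\<lambda>_. 1) \<in> B"
    and "\<And>f. f \<in> B \<Longrightarrow> P f \<in> B"
    and "\<kappa> > 0" and "0 < \<theta>" and "\<theta> < 1"
    and "\<And>f n. f \<in> B \<Longrightarrow>
           N (\<lambda>x. (P ^^ n) f x - (\<integral>y. f y \<partial>\<mu>)) \<le> \<kappa> * \<theta> ^ n * N f"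
    and "p \<ge> 1" and "B \<subseteq> Lr_space \<mu> p"
    and "C > 0" and "\<And>f. f \<in> B \<Longrightarrow> Lr_norm \<mu> p f \<le> C * N f"
    and "M > 0"
    and "\<And>f n. f \<in> B \<Longrightarrow>
           (\<lambda>x. f x * (P ^^ n) f x) \<in> B \<and>
           N (\<lambda>x. f x * (P ^^ n) f x) \<le> M * N f * N ((P ^^ n) f)"
    and "q \<ge> 1" and "1 / p + 1 / q = 1"
  shows "\<exists>K::real. \<forall>f\<in>B. \<forall>n\<ge>1.
    bounded (f ` space \<mu>) \<longrightarrow> (\<integral>x. f x \<partial>\<mu>) = 0 \<longrightarrow>
    (let m = max 1 (SUP x\<in>space \<mu>. \<bar>f x\<bar>) in
      (\<integral>x. (\<Sum>i=1..n. f ((T ^^ i) x)) ^ 4 \<partial>\<mu>)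
        \<le> K * m ^ 3 *
           (real n * Lr_norm \<mu> q f * (ln (N f + 1)) ^ 3
            + (real n)\<^sup>2 * (Lr_norm \<mu> q f)\<^sup>2 * (ln (N f + 1))\<^sup>2))"
proof -
  interpret prob_space \<mu> by fact
  interpret spectral_gap_space \<mu> T P B N \<kappa> \<theta> C M p q
    by unfold_locales (use assms in auto)
  show ?thesis by (rule fourth_moment_inequality)
qed

end
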